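(* Let $K=\mathbb{F}_2^{\mathrm{alg}}$ be the algebraic closure of the field with two elements. Then the group $\operatorname{SL}_2(K)$ of $2\times 2$ matrices over $K$ of determinant $1$ is amenable but not uniformly inner amenable.
   Context: A group $G$ is amenable if there is a finitely additive probability measure on all subsets of $G$ that is invariant under left multiplication by elements of $G$. For nonempty finite subsets $S,T\subseteq G$ and $\epsilon>0$, $T$ is called a $(S,\epsilon)$-c-Følner set if $|gTg^{-1}\triangle T|<\epsilon|T|$ for all $g\in S$. A group $G$ is uniformly inner amenable if there is a function $f:\mathbb{N}\to\mathbb{N}$ such that, for every $n\geq 1$ and every nonempty finite subset $S\subseteq G$ with $|S|\leq n$, there is a finite subset $T\subseteq G$ with $n\leq |T|\leq f(n)$ that is a $(S,\frac{1}{n})$-c-Følner set. *)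

theory Defs
  imports
    "HOL-Analysis.Analysis"
    "HOL-Algebra.Coset"
    "HOL-Algebra.Algebraic_Closure_Type"
    "HOL-Library.Z2"
begin

text \<open>
  The notions below are meant for groups in the sense of \<^locale>\<open>group\<close>. The values of the measure
  \<open>\<mu>\<close> on sets that are not subsets of the carrier are irrelevant.
\<close>

definition amenable :: "('a, 'b) monoid_scheme \<Rightarrow> bool" where
  "amenable G \<longleftrightarrow>
    (\<exists>\<mu> :: 'a set \<Rightarrow> real.
      (\<forall>A. A \<subseteq> carrier G \<longrightarrow> 0 \<le> \<mu> A) \<and>
      \<mu> (carrier G) = 1 \<and>
      (\<forall>A B. A \<subseteq> carrier G \<and> B \<subseteq> carrier G \<and> A \<inter> B = {} \<longrightarrow> \<mu> (A \<union> B) = \<mu> A + \<mu> B) \<and>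
      (\<forall>g A. g \<in> carrier G \<and> A \<subseteq> carrier G \<longrightarrow> \<mu> (g <#\<^bsub>G\<^esub> A) = \<mu> A))"

definition c_Folner :: "('a, 'b) monoid_scheme \<Rightarrow> 'a set \<Rightarrow> real \<Rightarrow> 'a set \<Rightarrow> bool" where
  "c_Folner G S \<epsilon> T \<longleftrightarrow>
    S \<subseteq> carrier G \<and> finite S \<and> S \<noteq> {} \<and>
    T \<subseteq> carrier G \<and> finite T \<and> T \<noteq> {} \<and>
    (\<forall>g\<in>S. real (card (sym_diff ((\<lambda>t. g \<otimes>\<^bsub>G\<^esub> t \<otimes>\<^bsub>G\<^esub> inv\<^bsub>G\<^esub> g) ` T) T)) < \<epsilon> * real (card T))"

definition uniformly_inner_amenable :: "('a, 'b) monoid_scheme \<Rightarrow> bool" where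
  "uniformly_inner_amenable G \<longleftrightarrow>
    (\<exists>f :: nat \<Rightarrow> nat. \<forall>n\<ge>1. \<forall>S.
      S \<subseteq> carrier G \<and> finite S \<and> S \<noteq> {} \<and> card S \<le> n \<longrightarrow>
        (\<exists>T. T \<subseteq> carrier G \<and> finite T \<and> n \<le> card T \<and> card T \<le> f n \<and>
             c_Folner G S (1 / real n) T))"

definition SL2 :: "('k::field ^ 2 ^ 2) monoid" where
  "SL2 = \<lparr>carrier = {A. det A = 1}, mult = (**), one = mat 1\<rparr>"

lemma group_SL2: "group (SL2 :: ('k::field ^ 2 ^ 2) monoid)"
proof (rule groupI)
  fix A :: "'k ^ 2 ^ 2"
  assume "A \<in> carrier SL2"
  then have d: "A$1$1 * A$2$2 - A$1$2 * A$2$1 = 1"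
    by (simp add: SL2_def det_2)
  define B :: "'k ^ 2 ^ 2" where
    "B = vector [vector [A$2$2, - A$1$2], vector [- A$2$1, A$1$1]]"
  have B: "B$1$1 = A$2$2" "B$1$2 = - A$1$2" "B$2$1 = - A$2$1" "B$2$2 = A$1$1"
    by (simp_all add: B_def)
  have "det B = 1"
    using d by (simp add: det_2 B algebra_simps)
  moreover have "B ** A = mat 1"
    using d by (simp add: vec_eq_iff forall_2 matrix_matrix_mult_def sum_2 B mat_def algebra_simps)
  ultimately show "\<exists>B\<in>carrier SL2. B \<otimes>\<^bsub>SL2\<^esub> A = \<one>\<^bsub>SL2\<^esub>"
    by (auto simp: SL2_def)
qed (auto simp: SL2_def det_mul matrix_mul_assoc)

type_synonym F2_alg = "bit alg_closure"

end

theory Submission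
  imports Defs
begin

text \<open>
  Amenability holds because the group is locally finite: every element of the algebraic closure
  \<open>K\<close> of the two-element field is fixed by a power of the Frobenius map, so \<open>K\<close> is an increasing
  union of finite subfields \<open>F\<^sub>k\<close>, and \<open>SL\<^sub>2(K)\<close> is the increasing union of the finite groups
  \<open>SL\<^sub>2(F\<^sub>k)\<close>. A cluster point of their uniform distributions, which exists by Tychonoff's theorem,
  is an invariant mean.

  Uniform inner amenability fails because the bound \<open>f n\<close> on the size of the conjugation-almost
  invariant sets may depend on \<open>n\<close> only, whereas the elements to be tested may be chosen after
  \<open>f n\<close> is known. Although \<open>SL\<^sub>2(K)\<close> contains no nontrivial free subgroups, it contains, for each \<open>L\<close>, three
  involutions none of whose nonempty reduced words of length at most \<open>L\<close> is trivial: three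
  transvections depending on a parameter \<open>r\<close> generate a free product of three groups of order two
  when \<open>r\<close> is an indeterminate, and only finitely many values of \<open>r\<close> make one of the finitely many
  words in question trivial (lemma \<open>transvections_locally_free\<close>).

  Let \<open>T\<close> be a finite set of nontrivial elements, and join \<open>t\<close> to its conjugates by the three
  involutions \<open>s i\<close>. If \<open>T\<close> is almost invariant, then nearly every vertex of this graph on \<open>T\<close> has
  degree three. Pruning the vertices of degree at most one leads to a subgraph
  with all degrees at least two and average degree above two, hence with a vertex \<open>v\<close> of degree three
  (lemma \<open>dense_core_exists\<close>). Walking on without turning back from \<open>v\<close>, once along each of the three
  edges, gives three reduced words of length at most \<open>2 |T|\<close> that begin with different
  letters and centralise \<open>v\<close> (lemma \<open>reduced_closed_walk_exists\<close>). Centralisers of nontrivial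
  elements of \<open>SL\<^sub>2\<close> in characteristic two are commutative, but two of the three words, possibly
  after inverting one, have a reduced commutator of length at most
  \<open>8 |T|\<close> (lemma \<open>reduced_commutator_exists\<close>). With \<open>L = 8 f n\<close> this is a contradiction.
\<close>

(* Below, the dollar sign denotes entries of vectors and never coefficients of power series. *)
unbundle no Formal_Power_Series.fps_syntax

section \<open>Graphs of involutions on finite sets\<close>

text \<open>
  The edges of the graph of a family of involutions \<open>\<phi> i\<close> that stay inside \<open>T\<close>, seen from both of
  their ends: an edge between distinct vertices is counted twice, a fixed point of \<open>\<phi> i\<close> once. The
  cardinality is thus the sum of all degrees.
\<close>

definition inner_edges :: "('i \<Rightarrow> 'v \<Rightarrow> 'v) \<Rightarrow> 'v set \<Rightarrow> ('v \<times> 'i) set" where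
  "inner_edges \<phi> T = (SIGMA t:T. {i. \<phi> i t \<in> T})"

lemma card_inner_edges:
  fixes \<phi> :: "'i::finite \<Rightarrow> 'v \<Rightarrow> 'v"
  assumes "finite T"
  shows "card (inner_edges \<phi> T) = (\<Sum>t\<in>T. card {i. \<phi> i t \<in> T})"
  using assms by (simp add: inner_edges_def card_SigmaI)

lemma card_inner_edges_by_label:
  fixes \<phi> :: "'i::finite \<Rightarrow> 'v \<Rightarrow> 'v"
  assumes "finite T"
  shows "card (inner_edges \<phi> T) = (\<Sum>i\<in>UNIV. card {t\<in>T. \<phi> i t \<in> T})"
proof -
  have "bij_betw prod.swap (inner_edges \<phi> T) (SIGMA i:UNIV. {t\<in>T. \<phi> i t \<in> T})"
    by (rule bij_betwI[where g = prod.swap]) (auto simp: inner_edges_def)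
  then have "card (inner_edges \<phi> T) = card (SIGMA i:UNIV. {t\<in>T. \<phi> i t \<in> T})"
    by (rule bij_betw_same_card)
  also have "\<dots> = (\<Sum>i\<in>UNIV. card {t\<in>T. \<phi> i t \<in> T})"
    using assms by (simp add: card_SigmaI)
  finally show ?thesis .
qed

text \<open>
  Deleting a vertex of degree at most one lowers the sum of degrees by at most two and twice the
  number of vertices by exactly two, so the inequality survives until no such vertex is left.
\<close>

lemma dense_core_exists:
  fixes \<phi> :: "'i::finite \<Rightarrow> 'v \<Rightarrow> 'v"
  assumes invol: "\<And>i t. \<phi> i (\<phi> i t) = t"
    and "finite T" and "2 * card T < card (inner_edges \<phi> T)"
  obtains T' where "T' \<subseteq> T" "2 * card T' < card (inner_edges \<phi> T')"
    "\<And>t. t \<in> T' \<Longrightarrow> 2 \<le> card {i. \<phi> i t \<in> T'}"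
proof -
  have "\<exists>T'\<subseteq>T. 2 * card T' < card (inner_edges \<phi> T') \<and>
      (\<forall>t\<in>T'. 2 \<le> card {i. \<phi> i t \<in> T'})"
    using assms(2,3)
  proof (induction T rule: finite_psubset_induct)
    case (psubset T)
    show ?case
    proof (cases "\<forall>t\<in>T. 2 \<le> card {i. \<phi> i t \<in> T}")
      case True
      with psubset.prems show ?thesis by blast
    next
      case False
      then obtain v where v: "v \<in> T" and deg: "card {i. \<phi> i v \<in> T} \<le> 1"
        by (auto simp: not_le)
      define D where "D = {i. \<phi> i v \<in> T}"
      have fin: "finite (inner_edges \<phi> (T - {v}))"
        using psubset.hyps by (simp add: inner_edges_def)
      \<comment> \<open>The edges at \<open>v\<close>, seen from \<open>v\<close> and from their other ends.\<close>
      have "inner_edges \<phi> T \<subseteq> inner_edges \<phi> (T - {v}) \<union> Pair v ` D \<union> (\<lambda>i. (\<phi> i v, i)) ` D"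
      proof
        fix e assume "e \<in> inner_edges \<phi> T"
        then obtain t i where e: "e = (t, i)" "t \<in> T" "\<phi> i t \<in> T"
          by (auto simp: inner_edges_def)
        consider "t = v" | "\<phi> i t = v" | "t \<noteq> v" "\<phi> i t \<noteq> v" by blast
        then show "e \<in> inner_edges \<phi> (T - {v}) \<union> Pair v ` D \<union> (\<lambda>i. (\<phi> i v, i)) ` D"
        proof cases
          case 2
          then have "t = \<phi> i v" using invol by metis
          with e show ?thesis by (auto simp: D_def)
        qed (use e in \<open>auto simp: D_def inner_edges_def\<close>)
      qed
      then have "card (inner_edges \<phi> T) \<le>
          card (inner_edges \<phi> (T - {v}) \<union> Pair v ` D \<union> (\<lambda>i. (\<phi> i v, i)) ` D)"
        using fin by (intro card_mono) auto
      also have "\<dots> \<le> card (inner_edges \<phi> (T - {v})) + card (Pair v ` D)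
          + card ((\<lambda>i. (\<phi> i v, i)) ` D)"
        using card_Un_le[of "inner_edges \<phi> (T - {v}) \<union> Pair v ` D" "(\<lambda>i. (\<phi> i v, i)) ` D"]
          card_Un_le[of "inner_edges \<phi> (T - {v})" "Pair v ` D"] by linarith
      also have "\<dots> \<le> card (inner_edges \<phi> (T - {v})) + card D + card D"
        by (intro add_mono card_image_le) auto
      finally have "card (inner_edges \<phi> T) \<le> card (inner_edges \<phi> (T - {v})) + 2"
        using deg by (simp add: D_def)
      moreover have "card T = Suc (card (T - {v}))"
        using v psubset.hyps card.remove by metis
      ultimately have "2 * card (T - {v}) < card (inner_edges \<phi> (T - {v}))"
        using psubset.prems by linarith
      moreover have "T - {v} \<subset> T" using v by blast
      ultimately obtain T' where "T' \<subseteq> T - {v}"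
        "2 * card T' < card (inner_edges \<phi> T') \<and> (\<forall>t\<in>T'. 2 \<le> card {i. \<phi> i t \<in> T'})"
        using psubset.IH by meson
      then show ?thesis by (intro exI[of _ T']) auto
    qed
  qed
  then show thesis using that by blast
qed

text \<open>
  With all degrees at least two, a walk can always be continued by a label different from the last
  one. On a finite vertex set it must run into itself; walking back along the initial part then
  closes it up to a lasso.
\<close>

lemma reduced_closed_walk_exists:
  assumes invol: "\<And>i t. \<phi> i (\<phi> i t) = t"
    and finT: "finite T" and v: "v \<in> T" "\<phi> i v \<in> T"
    and branching: "\<And>t i. t \<in> T \<Longrightarrow> \<exists>j. j \<noteq> i \<and> \<phi> j t \<in> T"
  obtains w where "w \<noteq> []" "distinct_adj w" "hd w = i" "length w \<le> 2 * card T"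
    "foldr \<phi> w v = v"
proof -
  let ?P = "\<lambda>(n::nat) p. fst p \<in> T \<and> \<phi> (snd p) (fst p) \<in> T \<and> (n = 0 \<longrightarrow> p = (v, i))"
  let ?Q = "\<lambda>(n::nat) p q. fst q = \<phi> (snd p) (fst p) \<and> snd q \<noteq> snd p"
  have "\<exists>f. \<forall>n. ?P n (f n) \<and> ?Q n (f n) (f (Suc n))"
  proof (rule dependent_nat_choice)
    show "\<exists>p. ?P 0 p" using assms by auto
    fix p :: "'b \<times> 'a" and n :: nat
    assume p: "?P n p"
    obtain j where "j \<noteq> snd p" "\<phi> j (\<phi> (snd p) (fst p)) \<in> T"
      using p branching by blast
    with p show "\<exists>q. ?P (Suc n) q \<and> ?Q n p q"
      by (intro exI[of _ "(\<phi> (snd p) (fst p), j)"]) auto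
  qed
  then obtain f where f: "\<And>n. ?P n (f n)" "\<And>n. ?Q n (f n) (f (Suc n))" by blast
  define y where "y n = fst (f n)" for n
  define x where "x n = snd (f n)" for n
  have y0: "y 0 = v" and x0: "x 0 = i" and yT: "y n \<in> T"
    and ySuc: "y (Suc n) = \<phi> (x n) (y n)" and xSuc: "x (Suc n) \<noteq> x n" for n
    using f[of 0] f[of n] by (auto simp: x_def y_def)
  have backward: "y n = \<phi> (x n) (y (Suc n))" for n
    by (simp add: ySuc invol)
  have forth_word: "foldr \<phi> (rev (map x [0..<n])) v = y n" for n
    by (induction n) (auto simp: y0 ySuc)
  have back_word: "foldr \<phi> (map x [0..<n]) (y n) = v" for n
    by (induction n) (auto simp: y0 simp flip: backward)
  have reduced: "distinct_adj (map x [0..<n])" for n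
    using xSuc by (auto simp: distinct_adj_conv_nth) metis

  have "\<not> inj_on y {..card T}"
  proof
    assume "inj_on y {..card T}"
    then have "card (y ` {..card T}) = Suc (card T)" by (simp add: card_image)
    moreover have "card (y ` {..card T}) \<le> card T"
      using yT \<open>finite T\<close> by (intro card_mono) auto
    ultimately show False by simp
  qed
  then have ex: "\<exists>p q. p < q \<and> q \<le> card T \<and> y p = y q"
    by (auto simp: inj_on_def) (metis linorder_neqE_nat)
  \<comment> \<open>The first vertex that is visited again: minimality of \<open>p\<close> makes the walk enter it by two
    different labels, so the lasso word below is reduced.\<close>
  define p where "p = (LEAST p. \<exists>q. p < q \<and> q \<le> card T \<and> y p = y q)"
  obtain q where q: "p < q" "q \<le> card T" "y p = y q"
    using LeastI_ex[OF ex] unfolding p_def by blast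
  have entry: "x (p - 1) \<noteq> x (q - 1)" if "p > 0"
  proof
    assume "x (p - 1) = x (q - 1)"
    then have "y (p - 1) = y (q - 1)"
      using backward[of "p - 1"] backward[of "q - 1"] q that by simp
    then have "\<exists>q. p - 1 < q \<and> q \<le> card T \<and> y (p - 1) = y q"
      using q that by (intro exI[of _ "q - 1"]) auto
    then have "p \<le> p - 1" unfolding p_def by (rule Least_le)
    with that show False by simp
  qed
  define w where "w = map x [0..<q] @ rev (map x [0..<p])"
  show thesis
  proof (rule that)
    show "w \<noteq> []" using q by (simp add: w_def)
    show "hd w = i" using q x0 by (simp add: w_def hd_append hd_map)
    show "length w \<le> 2 * card T" using q by (simp add: w_def)
    show "foldr \<phi> w v = v"
      using forth_word[of p] back_word[of q] q by (simp add: w_def)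
    show "distinct_adj w"
      using reduced[of p] reduced[of q] entry q
      by (auto simp: w_def distinct_adj_append_iff last_map hd_rev simp del: rev_map)
  qed
qed

text \<open>
  In a free product of groups of order two, commuting elements lie in a common cyclic subgroup,
  whose nontrivial elements begin with at most two different letters; three words with distinct first
  letters cannot all commute. Here \<open>rev\<close> is inversion, and the commutator of \<open>u\<close> and \<open>v\<close> is reduced as written once
  neither \<open>v @ u\<close> nor \<open>u @ v\<close> cancels and \<open>u\<close>, \<open>v\<close> begin differently.
\<close>

lemma reduced_commutator_exists:
  assumes ne: "w1 \<noteq> []" "w2 \<noteq> []" "w3 \<noteq> []"
    and red: "distinct_adj w1" "distinct_adj w2" "distinct_adj w3"
    and hd: "hd w1 \<noteq> hd w2" "hd w1 \<noteq> hd w3" "hd w2 \<noteq> hd w3"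
  obtains u v where "u \<in> {w1, w2, w3}" "v \<in> {w1, w2, w3, rev w1, rev w2, rev w3}"
    "distinct_adj (rev v @ rev u @ v @ u)"
proof -
  have comm: "distinct_adj (rev v @ rev u @ v @ u)"
    if "u \<noteq> []" "v \<noteq> []" "distinct_adj u" "distinct_adj v"
      "hd u \<noteq> hd v" "last u \<noteq> hd v" "last v \<noteq> hd u" for u v :: "'a list"
    using that by (auto simp: distinct_adj_append_iff hd_rev last_rev hd_append)
  consider "last w1 \<noteq> hd w2" "last w2 \<noteq> hd w1" | "last w1 \<noteq> hd w3" "last w3 \<noteq> hd w1"
    | "last w2 \<noteq> hd w3" "last w3 \<noteq> hd w2"
    | "last w1 = hd w2" "last w2 = hd w3" "last w3 = hd w1"
    | "last w1 = hd w3" "last w2 = hd w1" "last w3 = hd w2"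
    using hd by metis
  then show thesis
  proof cases
    case 1 with that[of w1 w2] comm[of w1 w2] assms show ?thesis by auto
  next
    case 2 with that[of w1 w3] comm[of w1 w3] assms show ?thesis by auto
  next
    case 3 with that[of w2 w3] comm[of w2 w3] assms show ?thesis by auto
  next
    \<comment> \<open>The words end in the first letters of one another cyclically; inverting one of them
      breaks the cycle.\<close>
    case 4 with that[of w1 "rev w2"] comm[of w1 "rev w2"] assms show ?thesis
      by (auto simp: hd_rev last_rev)
  next
    case 5 with that[of w2 "rev w1"] comm[of w2 "rev w1"] assms show ?thesis
      by (auto simp: hd_rev last_rev)
  qed
qed

section \<open>Uniform inner amenability and commutative centralisers\<close>

context group
begin

definition word_value :: "('i \<Rightarrow> 'a) \<Rightarrow> 'i list \<Rightarrow> 'a" where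
  "word_value s w = foldr (\<lambda>i a. s i \<otimes> a) w \<one>"

lemma word_value_simps [simp]:
  "word_value s [] = \<one>" "word_value s (i # w) = s i \<otimes> word_value s w"
  by (simp_all add: word_value_def)

lemma word_value_closed [simp, intro]:
  "(\<And>i. s i \<in> carrier G) \<Longrightarrow> word_value s w \<in> carrier G"
  by (induction w) auto

lemma word_value_append:
  "(\<And>i. s i \<in> carrier G) \<Longrightarrow> word_value s (u @ v) = word_value s u \<otimes> word_value s v"
  by (induction u) (auto simp: m_assoc)

lemma word_value_rev:
  assumes "\<And>i. s i \<in> carrier G" and "\<And>i. s i \<otimes> s i = \<one>"
  shows "word_value s (rev w) = inv (word_value s w)"
proof (induction w)
  case (Cons i w)
  have "inv (s i) = s i" using assms by (simp add: inv_equality)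
  with Cons assms show ?case by (simp add: word_value_append inv_mult_group)
qed simp

lemma commutator_eq_one:
  assumes "a \<in> carrier G" "b \<in> carrier G" "a \<otimes> b = b \<otimes> a"
  shows "inv b \<otimes> (inv a \<otimes> (b \<otimes> a)) = \<one>"
proof -
  have "inv b \<otimes> (inv a \<otimes> (b \<otimes> a)) = inv b \<otimes> (inv a \<otimes> (a \<otimes> b))"
    using assms by simp
  also have "\<dots> = \<one>"
    using assms by (metis inv_closed l_inv l_one m_assoc)
  finally show ?thesis .
qed

text \<open>
  Every component of the conjugation graph on \<open>T\<close> has at most one cycle: two independent cycles at
  a vertex would be noncommuting words in its commutative centraliser. The number \<open>8\<close> accounts for the
  four factors of a commutator of lassos of length at most \<open>2 * card T\<close>.
\<close>

lemma inner_edges_conjugation_le: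
  fixes s :: "'i::finite \<Rightarrow> 'a"
  assumes s: "\<And>i. s i \<in> carrier G" "\<And>i. s i \<otimes> s i = \<one>"
    and free: "\<And>w. w \<noteq> [] \<Longrightarrow> distinct_adj w \<Longrightarrow> length w \<le> 8 * card T \<Longrightarrow> word_value s w \<noteq> \<one>"
    and centr: "\<And>t a b. \<lbrakk>t \<in> carrier G; a \<in> carrier G; b \<in> carrier G; t \<noteq> \<one>;
        a \<otimes> t = t \<otimes> a; b \<otimes> t = t \<otimes> b\<rbrakk> \<Longrightarrow> a \<otimes> b = b \<otimes> a"
    and T: "finite T" "T \<subseteq> carrier G" "\<one> \<notin> T"
  shows "card (inner_edges (\<lambda>i t. s i \<otimes> t \<otimes> inv (s i)) T) \<le> 2 * card T"
proof (rule ccontr)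
  \<comment> \<open>Conjugation is replaced by the identity map outside the group to get involutions of the whole
    type.\<close>
  define \<phi> where "\<phi> i t = (if t \<in> carrier G then s i \<otimes> t \<otimes> inv (s i) else t)" for i t
  have inv_s: "inv (s i) = s i" for i using s by (simp add: inv_equality)
  have invol: "\<phi> i (\<phi> i t) = t" for i t
  proof (cases "t \<in> carrier G")
    case True
    have "s i \<otimes> (s i \<otimes> t \<otimes> s i) \<otimes> s i = (s i \<otimes> s i) \<otimes> t \<otimes> (s i \<otimes> s i)"
      using s(1) True by (simp add: m_assoc)
    with s True show ?thesis by (simp add: \<phi>_def inv_s)
  qed (simp add: \<phi>_def)
  have foldr_\<phi>: "foldr \<phi> w t = word_value s w \<otimes> t \<otimes> inv (word_value s w)"
    if "t \<in> carrier G" for w t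
    using s(1) that by (induction w) (auto simp: \<phi>_def inv_mult_group m_assoc)
  assume "\<not> ?thesis"
  moreover have "inner_edges (\<lambda>i t. s i \<otimes> t \<otimes> inv (s i)) T = inner_edges \<phi> T"
    using T by (auto simp: inner_edges_def \<phi>_def)
  ultimately have "2 * card T < card (inner_edges \<phi> T)" by simp
  from dense_core_exists[OF invol T(1) this]
  obtain T' where T': "T' \<subseteq> T" and dense: "2 * card T' < card (inner_edges \<phi> T')"
    and deg: "\<And>t. t \<in> T' \<Longrightarrow> 2 \<le> card {i. \<phi> i t \<in> T'}" by blast
  have finT': "finite T'" and cardT': "card T' \<le> card T"
    using T' T(1) finite_subset card_mono by auto
  have branching: "\<exists>j. j \<noteq> i \<and> \<phi> j t \<in> T'" if t: "t \<in> T'" for t i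
  proof (rule ccontr)
    assume "\<nexists>j. j \<noteq> i \<and> \<phi> j t \<in> T'"
    then have "{i. \<phi> i t \<in> T'} \<subseteq> {i}" by blast
    then have "card {i. \<phi> i t \<in> T'} \<le> card {i}" by (intro card_mono) auto
    with deg[OF t] show False by simp
  qed
  have "\<exists>v\<in>T'. 3 \<le> card {i. \<phi> i v \<in> T'}"
  proof (rule ccontr)
    assume "\<not> ?thesis"
    then have "(\<Sum>t\<in>T'. card {i. \<phi> i t \<in> T'}) \<le> (\<Sum>t\<in>T'. 2)"
      by (intro sum_mono) force
    with dense finT' show False by (simp add: card_inner_edges)
  qed
  then obtain v where v: "v \<in> T'" "3 \<le> card {i. \<phi> i v \<in> T'}" by blast
  have vG: "v \<in> carrier G" "v \<noteq> \<one>" using v(1) T' T by auto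
  obtain B where "B \<subseteq> {i. \<phi> i v \<in> T'}" "card B = 3"
    using v(2) obtain_subset_with_card_n by metis
  then obtain i1 i2 i3 where i: "\<phi> i1 v \<in> T'" "\<phi> i2 v \<in> T'" "\<phi> i3 v \<in> T'"
    "i1 \<noteq> i2" "i1 \<noteq> i3" "i2 \<noteq> i3"
    by (auto simp: card_3_iff)
  note walk = reduced_closed_walk_exists[OF invol finT' v(1) _ branching]
  obtain w1 where w1: "w1 \<noteq> []" "distinct_adj w1" "hd w1 = i1" "length w1 \<le> 2 * card T'"
    "foldr \<phi> w1 v = v" using walk[OF i(1)] by blast
  obtain w2 where w2: "w2 \<noteq> []" "distinct_adj w2" "hd w2 = i2" "length w2 \<le> 2 * card T'"
    "foldr \<phi> w2 v = v" using walk[OF i(2)] by blast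
  obtain w3 where w3: "w3 \<noteq> []" "distinct_adj w3" "hd w3 = i3" "length w3 \<le> 2 * card T'"
    "foldr \<phi> w3 v = v" using walk[OF i(3)] by blast
  obtain u u' where u: "u \<in> {w1, w2, w3}" "u' \<in> {w1, w2, w3, rev w1, rev w2, rev w3}"
    and red: "distinct_adj (rev u' @ rev u @ u' @ u)"
    using reduced_commutator_exists[of w1 w2 w3] w1 w2 w3 i by metis
  have len: "length u \<le> 2 * card T" "length u' \<le> 2 * card T" "u \<noteq> []"
    using u w1 w2 w3 cardT' by auto
  have fixes_inv: "foldr \<phi> (rev w) v = v" if "foldr \<phi> w v = v" for w
  proof -
    have "foldr \<phi> (rev w) (foldr \<phi> w t) = t" for t
      by (induction w arbitrary: t) (auto simp: invol)
    with that show ?thesis by metis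
  qed
  have comm_v: "word_value s w \<otimes> v = v \<otimes> word_value s w" if "foldr \<phi> w v = v" for w
    using that vG s(1) by (metis foldr_\<phi> inv_solve_right m_closed word_value_closed)
  have "foldr \<phi> u v = v" "foldr \<phi> u' v = v"
    using u w1 w2 w3 fixes_inv by auto
  then have "word_value s u \<otimes> word_value s u' = word_value s u' \<otimes> word_value s u"
    using s(1) vG by (metis centr comm_v word_value_closed)
  then have "word_value s (rev u' @ rev u @ u' @ u) = \<one>"
    using s by (simp add: word_value_append word_value_rev commutator_eq_one)
  with free[OF _ red] len show False by simp
qed

text \<open>
  Let \<open>m\<close> be the number of involutions. A set \<open>T\<close> with the invariance required for \<open>n = 2 * m\<close> has
  degree sum more than \<open>(m - 1/2) * card T\<close>, of which removing the identity costs at most \<open>m\<close>. As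
  \<open>m \<ge> 3\<close> and \<open>card T \<ge> 2 * m\<close>, more than \<open>2 * card T\<close> remains, so \<open>T\<close> is too dense for the previous
  lemma.
\<close>

lemma not_uniformly_inner_amenable_if_locally_free:
  assumes three: "CARD('i::finite) \<ge> 3"
    and free: "\<And>L. \<exists>s :: 'i \<Rightarrow> 'a. (\<forall>i. s i \<in> carrier G \<and> s i \<otimes> s i = \<one>) \<and>
      (\<forall>w. w \<noteq> [] \<and> distinct_adj w \<and> length w \<le> L \<longrightarrow> word_value s w \<noteq> \<one>)"
    and centr: "\<And>t a b. \<lbrakk>t \<in> carrier G; a \<in> carrier G; b \<in> carrier G; t \<noteq> \<one>;
        a \<otimes> t = t \<otimes> a; b \<otimes> t = t \<otimes> b\<rbrakk> \<Longrightarrow> a \<otimes> b = b \<otimes> a"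
  shows "\<not> uniformly_inner_amenable G"
proof
  assume "uniformly_inner_amenable G"
  then obtain f :: "nat \<Rightarrow> nat" where f: "\<And>n S. n \<ge> 1 \<Longrightarrow>
      S \<subseteq> carrier G \<and> finite S \<and> S \<noteq> {} \<and> card S \<le> n \<Longrightarrow>
      \<exists>T. T \<subseteq> carrier G \<and> finite T \<and> n \<le> card T \<and> card T \<le> f n \<and> c_Folner G S (1 / real n) T"
    unfolding uniformly_inner_amenable_def by meson
  define m where "m = CARD('i)"
  obtain s :: "'i \<Rightarrow> 'a" where s: "\<And>i. s i \<in> carrier G" "\<And>i. s i \<otimes> s i = \<one>"
    and red: "\<And>w. w \<noteq> [] \<Longrightarrow> distinct_adj w \<Longrightarrow> length w \<le> 8 * f (2 * m) \<Longrightarrow> word_value s w \<noteq> \<one>"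
    using free[of "8 * f (2 * m)"] by auto
  have "card (range s) \<le> m" unfolding m_def by (rule card_image_le) simp
  with s(1) three obtain T where T: "T \<subseteq> carrier G" "finite T" "2 * m \<le> card T" "card T \<le> f (2 * m)"
    "c_Folner G (range s) (1 / real (2 * m)) T"
    using f[of "2 * m" "range s"] by (auto simp: m_def)
  let ?c = "\<lambda>i t. s i \<otimes> t \<otimes> inv (s i)"
  define T' where "T' = T - {\<one>}"
  have T': "finite T'" "T' \<subseteq> carrier G" "\<one> \<notin> T'" "card T' \<le> card T"
    using T by (auto simp: T'_def card_Diff1_le)
  have "card (inner_edges ?c T') \<le> 2 * card T'"
  proof (rule inner_edges_conjugation_le[OF s])
    show "word_value s w \<noteq> \<one>" if "w \<noteq> []" "distinct_adj w" "length w \<le> 8 * card T'" for w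
      using that red T T'(4) by simp
  qed (use centr T' in auto)
  moreover have "real (card {t\<in>T'. ?c i t \<in> T'}) > real (card T) - real (card T) / (2 * m) - 1" for i
  proof -
    have "real (card (sym_diff (?c i ` T) T)) < 1 / real (2 * m) * real (card T)"
      using T(5) by (auto simp: c_Folner_def)
    moreover have "card {t\<in>T. ?c i t \<notin> T} \<le> card (sym_diff (?c i ` T) T)"
    proof (rule card_inj_on_le)
      show "inj_on (?c i) {t\<in>T. ?c i t \<notin> T}"
        using s(1) T(1) by (intro inj_onI) (simp add: subset_iff)
    qed (use T(2) in auto)
    moreover have "card T \<le> card ({t\<in>T'. ?c i t \<in> T'} \<union> {t\<in>T. ?c i t \<notin> T} \<union> {\<one>})"
    proof (rule card_mono)
      have "?c i t \<noteq> \<one>" if "t \<in> T" "t \<noteq> \<one>" for t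
      proof
        assume "?c i t = \<one>"
        then have "s i \<otimes> t = s i \<otimes> \<one>"
          using s(1) T(1) that by (simp add: inv_solve_right' subset_iff)
        with that s(1) T(1) show False by (metis l_cancel one_closed subsetD)
      qed
      then show "T \<subseteq> {t\<in>T'. ?c i t \<in> T'} \<union> {t\<in>T. ?c i t \<notin> T} \<union> {\<one>}"
        by (auto simp: T'_def)
    qed (use T(2) T'(1) in auto)
    moreover have "card ({t\<in>T'. ?c i t \<in> T'} \<union> {t\<in>T. ?c i t \<notin> T} \<union> {\<one>}) \<le>
        card {t\<in>T'. ?c i t \<in> T'} + card {t\<in>T. ?c i t \<notin> T} + 1"
      using card_Un_le[of "{t\<in>T'. ?c i t \<in> T'} \<union> {t\<in>T. ?c i t \<notin> T}" "{\<one>}"]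
        card_Un_le[of "{t\<in>T'. ?c i t \<in> T'}" "{t\<in>T. ?c i t \<notin> T}"] by simp
    ultimately show ?thesis by simp
  qed
  then have "(\<Sum>i\<in>(UNIV :: 'i set). real (card T) - real (card T) / (2 * m) - 1)
      < (\<Sum>i\<in>UNIV. real (card {t\<in>T'. ?c i t \<in> T'}))"
    by (intro sum_strict_mono) auto
  then have "m * (real (card T) - real (card T) / (2 * m) - 1) < card (inner_edges ?c T')"
    using T'(1) by (simp add: card_inner_edges_by_label m_def)
  ultimately have "m * (real (card T) - real (card T) / (2 * m) - 1) < 2 * real (card T)"
    using T'(4) by linarith
  moreover have "m * (real (card T) - real (card T) / (2 * m) - 1) = (m - 1/2) * real (card T) - m"
    using three by (simp add: m_def field_simps)
  ultimately have "(m - 5/2) * real (card T) < m"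
    by (simp add: algebra_simps)
  moreover have "1/2 * real (2 * m) \<le> (m - 5/2) * real (card T)"
    using three T(3) by (intro mult_mono) (auto simp: m_def)
  ultimately show False by simp
qed

end

section \<open>Reduced words in three transvections\<close>

text \<open>
  The maps \<open>x \<mapsto> x + r * \<omega>(u\<^sub>i, x) * u\<^sub>i\<close> for the three vectors \<open>u\<^sub>1 = (1, 0)\<close>, \<open>u\<^sub>2 = (0, 1)\<close>,
  \<open>u\<^sub>3 = (1, 1)\<close>, where \<open>\<omega>\<close> is the determinant form; the signs disappear in characteristic two. Any
  two of the vectors have \<open>\<omega>(u\<^sub>i, u\<^sub>j) = 1\<close>, which makes the three maps play symmetric roles.
\<close>

definition transvection :: "'k::field \<Rightarrow> 3 \<Rightarrow> 'k ^ 2 ^ 2" where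
  "transvection r i =
    (if i = 1 then vector [vector [1, r], vector [0, 1]]
     else if i = 2 then vector [vector [1, 0], vector [r, 1]]
     else vector [vector [1 + r, r], vector [r, 1 + r]])"

text \<open>
  In characteristic two, the linear form \<open>\<omega>(u\<^sub>i, x)\<close>, which vanishes on the axis of the transvection with index \<open>i\<close>.
\<close>

definition axis_form :: "3 \<Rightarrow> 'k::field ^ 2 \<Rightarrow> 'k" where
  "axis_form i x = (if i = 1 then x $ 2 else if i = 2 then x $ 1 else x $ 1 + x $ 2)"

lemma double_eq_zero:
  fixes x :: "'k::field"
  assumes "CHAR('k) = 2"
  shows "x + x = 0"
proof -
  have "(of_nat 2 :: 'k) = 0" using assms of_nat_CHAR by metis
  then have "(1 + 1 :: 'k) = 0" by simp
  then have "(1 + 1) * x = 0" by simp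
  then show ?thesis by (simp add: ring_distribs)
qed

lemma transvection_in_SL2:
  assumes "CHAR('k::field) = 2"
  shows "transvection (r :: 'k) i \<in> carrier SL2"
  using double_eq_zero[OF assms, of r]
  by (auto simp: SL2_def transvection_def det_2 algebra_simps)

lemma transvection_square:
  assumes "CHAR('k::field) = 2"
  shows "transvection (r :: 'k) i ** transvection r i = mat 1"
  using double_eq_zero[OF assms, of r] double_eq_zero[OF assms, of "r * r"]
  by (auto simp: transvection_def vec_eq_iff forall_2 matrix_matrix_mult_def sum_2 mat_def algebra_simps)

lemma axis_form_transvection:
  fixes r :: "'k::field"
  assumes "CHAR('k) = 2"
  shows "axis_form j (transvection r i *v x) =
    (if j = i then axis_form i x else axis_form j x + r * axis_form i x)"
proof -
  have "(2 :: 'k) = 0"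
    using assms of_nat_CHAR[where 'a = 'k] by simp
  then show ?thesis
    using exhaust_3[of i] exhaust_3[of j]
    by (elim disjE)
      (simp_all add: axis_form_def transvection_def matrix_vector_mult_def sum_2 algebra_simps)
qed

text \<open>
  The action of a transvection on the three linear forms of a vector, with the parameter replaced by
  an indeterminate.
\<close>

definition poly_transvection :: "'i \<Rightarrow> ('i \<Rightarrow> 'k::field poly) \<Rightarrow> 'i \<Rightarrow> 'k poly" where
  "poly_transvection i c j = (if j = i then c i else c j + pCons 0 (c i))"

text \<open>
  Ping-pong by degrees. After a word of length \<open>n\<close> with outermost letter \<open>k\<close>, all coordinates other
  than \<open>k\<close> have degree exactly \<open>n\<close>, so the next letter \<open>i \<noteq> k\<close> adds a term of degree \<open>n + 1\<close> to all
  coordinates other than \<open>i\<close>. The start vector \<open>c\<^sub>0\<close> looks as if \<open>i\<^sub>0\<close> had just been applied, which is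
  why \<open>i\<^sub>0\<close> is appended to the word.
\<close>

lemma degree_poly_transvection_word:
  fixes i\<^sub>0 :: 'i
  defines "c\<^sub>0 \<equiv> \<lambda>j. if j = i\<^sub>0 then 0 else (1 :: 'k::field poly)"
  assumes "distinct_adj (w @ [i\<^sub>0])"
  shows "(\<forall>j. j \<noteq> hd (w @ [i\<^sub>0]) \<longrightarrow>
        foldr poly_transvection w c\<^sub>0 j \<noteq> 0 \<and> Polynomial.degree (foldr poly_transvection w c\<^sub>0 j) = length w)
    \<and> Polynomial.degree (foldr poly_transvection w c\<^sub>0 (hd (w @ [i\<^sub>0]))) \<le> length w"
  using assms(2)
proof (induction w)
  case Nil
  then show ?case by (simp add: c\<^sub>0_def)
next
  case (Cons i w)
  define c where "c = foldr poly_transvection w c\<^sub>0"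
  define k where "k = hd (w @ [i\<^sub>0])"
  have ik: "i \<noteq> k" using Cons.prems by (simp add: k_def distinct_adj_Cons)
  have IH: "\<forall>j. j \<noteq> k \<longrightarrow> c j \<noteq> 0 \<and> Polynomial.degree (c j) = length w" "Polynomial.degree (c k) \<le> length w"
    using Cons by (auto simp: c_def k_def distinct_adj_Cons)
  have deg: "Polynomial.degree (c j) \<le> length w" for j using IH by (cases "j = k") auto
  have shift: "Polynomial.degree (pCons 0 (c i)) = Suc (length w)" using IH ik by simp
  have new: "Polynomial.degree (c j + pCons 0 (c i)) = Suc (length w)" for j
    using deg[of j] shift by (subst degree_add_eq_right) auto
  have nonzero: "c j + pCons 0 (c i) \<noteq> 0" for j
    using new[of j] by (metis degree_0 nat.distinct(1))
  have step: "foldr poly_transvection (i # w) c\<^sub>0 = poly_transvection i c"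
    by (simp add: c_def)
  show ?case
    unfolding step using nonzero new le_SucI[OF deg[of i]]
    by (simp add: poly_transvection_def)
qed

lemma poly_transvection_word:
  fixes r :: "'k::field"
  assumes "CHAR('k) = 2" and "\<And>j. poly (c j) r = axis_form j x"
  shows "poly (foldr poly_transvection w c j) r =
    axis_form j (foldr (\<lambda>i A. transvection r i ** A) w (mat 1) *v x)"
  using assms(2)
  by (induction w arbitrary: j)
    (auto simp: poly_transvection_def axis_form_transvection[OF assms(1)]
      simp flip: matrix_vector_mul_assoc)

text \<open>
  A trivial word fixes the start vector, so the parameter is a root of the difference between a
  polynomial of positive degree and a constant.
\<close>

lemma finite_transvection_relation:
  assumes char2: "CHAR('k::field) = 2" and "w \<noteq> []" and "distinct_adj w"
  shows "finite {r :: 'k. foldr (\<lambda>i A. transvection r i ** A) w (mat 1) = mat 1}"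
proof -
  \<comment> \<open>The vector \<open>x\<close> below is the direction of the transvection \<open>i\<^sub>0\<close>, so that its form \<open>i\<^sub>0\<close>
    vanishes and the other two are \<open>1\<close>.\<close>
  obtain i\<^sub>0 :: 3 where i0: "i\<^sub>0 \<noteq> last w"
    by (metis exhaust_3 one_neq_zero)
  obtain j :: 3 where j: "j \<noteq> hd w"
    by (metis exhaust_3 one_neq_zero)
  define c\<^sub>0 where "c\<^sub>0 = (\<lambda>j. if j = i\<^sub>0 then 0 else (1 :: 'k poly))"
  define x :: "'k ^ 2" where
    "x = (if i\<^sub>0 = 1 then vector [1, 0] else if i\<^sub>0 = 2 then vector [0, 1] else vector [1, 1])"
  have start: "poly (c\<^sub>0 j) r = axis_form j x" for j r
    using exhaust_3[of i\<^sub>0] exhaust_3[of j] double_eq_zero[OF char2, of 1]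
    by (auto simp: c\<^sub>0_def x_def axis_form_def)
  define p where "p = foldr poly_transvection w c\<^sub>0 j"
  have "distinct_adj (w @ [i\<^sub>0])"
    using assms i0 by (simp add: distinct_adj_append_iff)
  from degree_poly_transvection_word[OF this, where 'k = 'k]
  have "Polynomial.degree p = length w"
    using j \<open>w \<noteq> []\<close> by (simp add: p_def c\<^sub>0_def hd_append)
  then have "p - c\<^sub>0 j \<noteq> 0"
    using \<open>w \<noteq> []\<close> by (auto simp: c\<^sub>0_def)
  then have "finite {r. poly (p - c\<^sub>0 j) r = 0}" by (rule poly_roots_finite)
  moreover have "{r. foldr (\<lambda>i A. transvection r i ** A) w (mat 1) = mat 1} \<subseteq>
      {r. poly (p - c\<^sub>0 j) r = 0}"
    using start by (auto simp: p_def poly_transvection_word[OF char2 start])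
  ultimately show ?thesis by (rule finite_subset[rotated])
qed

lemma transvections_locally_free:
  assumes "CHAR('k::field) = 2" and "infinite (UNIV :: 'k set)"
  shows "\<exists>r::'k. \<forall>w. w \<noteq> [] \<and> distinct_adj w \<and> length w \<le> L \<longrightarrow>
    foldr (\<lambda>i A. transvection r i ** A) w (mat 1) \<noteq> mat 1"
proof -
  define W where "W = {w :: 3 list. w \<noteq> [] \<and> distinct_adj w \<and> length w \<le> L}"
  have "finite {w :: 3 list. set w \<subseteq> UNIV \<and> length w \<le> L}"
    by (rule finite_lists_length_le) simp
  then have "finite W" by (rule finite_subset[rotated]) (auto simp: W_def)
  then have "finite (\<Union>w\<in>W. {r :: 'k. foldr (\<lambda>i A. transvection r i ** A) w (mat 1) = mat 1})"
    using finite_transvection_relation[OF assms(1)] by (auto simp: W_def)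
  then obtain r :: 'k where
    "r \<notin> (\<Union>w\<in>W. {r. foldr (\<lambda>i A. transvection r i ** A) w (mat 1) = mat 1})"
    using assms(2) by (metis ex_new_if_finite)
  then show ?thesis by (auto simp: W_def)
qed

lemma multiple_if_cross_product_eq_zero:
  fixes t\<^sub>1 t\<^sub>2 t\<^sub>3 x\<^sub>1 x\<^sub>2 x\<^sub>3 :: "'k::field"
  assumes "x\<^sub>1 * t\<^sub>2 = t\<^sub>1 * x\<^sub>2" "t\<^sub>1 * x\<^sub>3 = x\<^sub>1 * t\<^sub>3" "t\<^sub>2 * x\<^sub>3 = x\<^sub>2 * t\<^sub>3"
    and "t\<^sub>1 \<noteq> 0 \<or> t\<^sub>2 \<noteq> 0 \<or> t\<^sub>3 \<noteq> 0"
  obtains p where "x\<^sub>1 = p * t\<^sub>1" "x\<^sub>2 = p * t\<^sub>2" "x\<^sub>3 = p * t\<^sub>3"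
proof -
  consider "t\<^sub>1 \<noteq> 0" | "t\<^sub>2 \<noteq> 0" | "t\<^sub>3 \<noteq> 0" using assms(4) by blast
  then show thesis
  proof cases
    case 1
    with assms that[of "x\<^sub>1 / t\<^sub>1"] show ?thesis by (simp add: nonzero_eq_divide_eq mult.commute)
  next
    case 2
    with assms that[of "x\<^sub>2 / t\<^sub>2"] show ?thesis by (simp add: nonzero_eq_divide_eq mult.commute)
  next
    case 3
    with assms that[of "x\<^sub>3 / t\<^sub>3"] show ?thesis by (simp add: nonzero_eq_divide_eq mult.commute)
  qed
qed

text \<open>
  In characteristic two the only scalar matrix of determinant one is the identity. For a nonscalar
  \<open>t\<close>, commuting with \<open>t\<close> means that the vector formed by the two off-diagonal entries and the
  difference of the diagonal entries is a multiple of that of \<open>t\<close>, so that every matrix commuting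
  with \<open>t\<close> is a linear combination of \<open>t\<close> and the identity.
\<close>

lemma SL2_centralisers_commutative:
  fixes t a b :: "'k::field ^ 2 ^ 2"
  assumes char2: "CHAR('k) = 2" and t: "det t = 1" "t \<noteq> mat 1"
    and comm: "a ** t = t ** a" "b ** t = t ** b"
  shows "a ** b = b ** a"
proof -
  have nonscalar: "t$1$2 \<noteq> 0 \<or> t$2$1 \<noteq> 0 \<or> t$1$1 \<noteq> t$2$2"
  proof (rule ccontr)
    assume *: "\<not> ?thesis"
    with t(1) have "t$1$1 * t$1$1 = 1" by (simp add: det_2)
    then have "t$1$1 = 1 \<or> t$1$1 = -1" by (simp add: square_eq_1_iff)
    moreover have "-1 = (1::'k)"
      using double_eq_zero[OF char2, of 1] by (simp add: minus_equation_iff eq_neg_iff_add_eq_0)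
    ultimately have "t = mat 1" using * by (auto simp: vec_eq_iff forall_2 mat_def)
    with t(2) show False ..
  qed
  have proportional: "c$1$2 * t$2$1 = t$1$2 * c$2$1"
    "t$1$2 * (c$1$1 - c$2$2) = c$1$2 * (t$1$1 - t$2$2)"
    "t$2$1 * (c$1$1 - c$2$2) = c$2$1 * (t$1$1 - t$2$2)" if "c ** t = t ** c" for c
  proof -
    have entry: "c$i$1 * t$1$j + c$i$2 * t$2$j = t$i$1 * c$1$j + t$i$2 * c$2$j" for i j
      using arg_cong[OF that, of "\<lambda>d. d $ i $ j"] by (simp add: matrix_matrix_mult_def sum_2)
    show "c$1$2 * t$2$1 = t$1$2 * c$2$1"
      using entry[of 1 1] by (simp add: mult.commute)
    have "t$1$2 * (c$1$1 - c$2$2) - c$1$2 * (t$1$1 - t$2$2) =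
        (c$1$1 * t$1$2 + c$1$2 * t$2$2) - (t$1$1 * c$1$2 + t$1$2 * c$2$2)"
      by (simp add: algebra_simps)
    then show "t$1$2 * (c$1$1 - c$2$2) = c$1$2 * (t$1$1 - t$2$2)"
      using entry[of 1 2] by simp
    have "c$2$1 * (t$1$1 - t$2$2) - t$2$1 * (c$1$1 - c$2$2) =
        (c$2$1 * t$1$1 + c$2$2 * t$2$1) - (t$2$1 * c$1$1 + t$2$2 * c$2$1)"
      by (simp add: algebra_simps)
    then show "t$2$1 * (c$1$1 - c$2$2) = c$2$1 * (t$1$1 - t$2$2)"
      using entry[of 2 1] by simp
  qed
  have nonzero: "t$1$2 \<noteq> 0 \<or> t$2$1 \<noteq> 0 \<or> t$1$1 - t$2$2 \<noteq> 0"
    using nonscalar by simp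
  obtain p where p: "a$1$2 = p * t$1$2" "a$2$1 = p * t$2$1" "a$1$1 - a$2$2 = p * (t$1$1 - t$2$2)"
    using multiple_if_cross_product_eq_zero[OF proportional[OF comm(1)] nonzero] .
  obtain q where q: "b$1$2 = q * t$1$2" "b$2$1 = q * t$2$1" "b$1$1 - b$2$2 = q * (t$1$1 - t$2$2)"
    using multiple_if_cross_product_eq_zero[OF proportional[OF comm(2)] nonzero] .
  have diag: "a$1$1 = a$2$2 + p * (t$1$1 - t$2$2)" "b$1$1 = b$2$2 + q * (t$1$1 - t$2$2)"
    using p(3) q(3) by (simp_all add: diff_eq_eq add.commute)
  show ?thesis
    by (simp add: vec_eq_iff forall_2 matrix_matrix_mult_def sum_2 p(1,2) q(1,2) diag)
      (simp add: algebra_simps)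
qed

lemma infinite_alg_closed: "infinite (UNIV :: 'k::alg_closed_field set)"
proof
  assume fin: "finite (UNIV :: 'k set)"
  define p where "p = (\<Prod>a\<in>UNIV. [:-a, 1:]) + (1 :: 'k poly)"
  have deg: "Polynomial.degree (\<Prod>a\<in>UNIV. [:-a, 1 :: 'k:]) = card (UNIV :: 'k set)"
    by (subst degree_prod_eq_sum_degree) auto
  have "Polynomial.degree p = card (UNIV :: 'k set)"
    unfolding p_def using fin deg by (subst degree_add_eq_left) (auto simp: card_gt_0_iff)
  then obtain x where "poly p x = 0"
    using alg_closed_imp_poly_has_root[of p] fin by (auto simp: card_gt_0_iff)
  moreover have "poly p x = 1"
    using fin by (auto simp: p_def poly_prod)
  ultimately show False by simp
qed

lemma not_uniformly_inner_amenable_SL2: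
  assumes char2: "CHAR('k::field) = 2" and "infinite (UNIV :: 'k set)"
  shows "\<not> uniformly_inner_amenable (SL2 :: ('k ^ 2 ^ 2) monoid)"
proof -
  let ?G = "SL2 :: ('k ^ 2 ^ 2) monoid"
  interpret SL2: group ?G by (rule group_SL2)
  have value_eq: "SL2.word_value s w = foldr (\<lambda>i A. s i ** A) w (mat 1)" for s :: "3 \<Rightarrow> 'k ^ 2 ^ 2" and w
    by (simp add: SL2.word_value_def) (simp add: SL2_def)
  show ?thesis
  proof (rule SL2.not_uniformly_inner_amenable_if_locally_free[where 'i = 3])
    show "3 \<le> CARD(3)" by simp
  next
    fix L
    obtain r :: 'k where r: "\<And>w. w \<noteq> [] \<Longrightarrow> distinct_adj w \<Longrightarrow> length w \<le> L \<Longrightarrow>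
        foldr (\<lambda>i A. transvection r i ** A) w (mat 1) \<noteq> mat 1"
      using transvections_locally_free[OF assms] by blast
    have "transvection r i \<otimes>\<^bsub>?G\<^esub> transvection r i = \<one>\<^bsub>?G\<^esub>" for i
      using transvection_square[OF char2] by (simp add: SL2_def)
    moreover have "SL2.word_value (transvection r) w \<noteq> \<one>\<^bsub>?G\<^esub>"
      if "w \<noteq> []" "distinct_adj w" "length w \<le> L" for w
      using r[OF that] unfolding value_eq by (simp add: SL2_def)
    ultimately show "\<exists>s :: 3 \<Rightarrow> 'k ^ 2 ^ 2.
        (\<forall>i. s i \<in> carrier ?G \<and> s i \<otimes>\<^bsub>?G\<^esub> s i = \<one>\<^bsub>?G\<^esub>) \<and>
        (\<forall>w. w \<noteq> [] \<and> distinct_adj w \<and> length w \<le> L \<longrightarrow> SL2.word_value s w \<noteq> \<one>\<^bsub>?G\<^esub>)"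
      using transvection_in_SL2[OF char2] by blast
  next
    fix t a b
    assume "t \<in> carrier ?G" "t \<noteq> \<one>\<^bsub>?G\<^esub>"
      "a \<otimes>\<^bsub>?G\<^esub> t = t \<otimes>\<^bsub>?G\<^esub> a" "b \<otimes>\<^bsub>?G\<^esub> t = t \<otimes>\<^bsub>?G\<^esub> b"
    then show "a \<otimes>\<^bsub>?G\<^esub> b = b \<otimes>\<^bsub>?G\<^esub> a"
      using SL2_centralisers_commutative[OF char2, of t a b] by (simp add: SL2_def)
  qed
qed

section \<open>Amenability of locally finite groups\<close>

text \<open>
  The uniform distributions on the subgroups \<open>H k\<close> are points of the compact space of functions from
  sets to the unit interval. Each of them is finitely additive, and all but finitely many are
  invariant under a given element; both are closed conditions that pass to a cluster point.
\<close>

lemma (in group) amenable_if_increasing_union_of_finite_subgroups: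
  assumes sub: "\<And>k::nat. subgroup (H k) G" and fin: "\<And>k. finite (H k)"
    and mono: "incseq H" and union: "(\<Union>k. H k) = carrier G"
  shows "amenable G"
proof -
  define \<mu> where "\<mu> k A = real (card (A \<inter> H k)) / real (card (H k))" for k A
  have pos: "card (H k) > 0" for k
    using fin subgroup.one_closed[OF sub] by (auto simp: card_gt_0_iff)
  let ?F = "filtermap \<mu> sequentially"
  have "compact (PiE UNIV (\<lambda>_. {0..1}) :: ('a set \<Rightarrow> real) set)"
    using compactin_PiE[of "\<lambda>_. euclidean :: real topology" UNIV "\<lambda>_. {0..1} :: real set"]
    by (simp add: euclidean_product_topology)
  moreover have "eventually (\<lambda>\<nu>. \<nu> \<in> PiE UNIV (\<lambda>_. {0..1})) ?F"
    using fin pos by (auto simp: eventually_filtermap \<mu>_def divide_le_eq intro!: card_mono always_eventually)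
  moreover have "?F \<noteq> bot" by (simp add: filtermap_bot_iff)
  ultimately obtain \<nu> where \<nu>: "\<nu> \<in> PiE UNIV (\<lambda>_. {0..1::real})" "inf (nhds \<nu>) ?F \<noteq> bot"
    unfolding compact_filter by blast
  \<comment> \<open>A cluster point inherits every closed condition that the \<open>\<mu> k\<close> satisfy eventually.\<close>
  have limit: "f \<nu> = g \<nu>" if ev: "eventually (\<lambda>k. f (\<mu> k) = g (\<mu> k)) sequentially"
    and cont: "continuous_on UNIV f" "continuous_on UNIV g" for f g :: "('a set \<Rightarrow> real) \<Rightarrow> real"
  proof (rule ccontr)
    assume "f \<nu> \<noteq> g \<nu>"
    moreover have "open (- {\<nu>. f \<nu> = g \<nu>})"
      using cont by (intro open_Compl closed_Collect_eq)
    ultimately have "eventually (\<lambda>\<nu>. f \<nu> \<noteq> g \<nu>) (nhds \<nu>)"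
      using eventually_nhds_in_open by force
    moreover have "eventually (\<lambda>\<nu>. f \<nu> = g \<nu>) ?F"
      using ev by (simp add: eventually_filtermap)
    ultimately have "eventually (\<lambda>_. False) (inf (nhds \<nu>) ?F)"
      unfolding eventually_inf by blast
    with \<nu>(2) show False by (simp add: trivial_limit_def)
  qed
  note cont = continuous_on_product_coordinates continuous_on_add continuous_on_const
  have "0 \<le> \<nu> A" for A using \<nu>(1) by (auto simp: PiE_iff)
  moreover have "\<nu> (carrier G) = 1"
  proof (rule limit[of "\<lambda>\<nu>. \<nu> (carrier G)" "\<lambda>_. 1"])
    have "carrier G \<inter> H k = H k" for k using union by blast
    then show "eventually (\<lambda>k. \<mu> k (carrier G) = 1) sequentially"
      using pos by (simp add: \<mu>_def)
  qed (intro cont)+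
  moreover have "\<nu> (A \<union> B) = \<nu> A + \<nu> B" if "A \<inter> B = {}" for A B
  proof (rule limit[of "\<lambda>\<nu>. \<nu> (A \<union> B)" "\<lambda>\<nu>. \<nu> A + \<nu> B"])
    have "card ((A \<union> B) \<inter> H k) = card (A \<inter> H k) + card (B \<inter> H k)" for k
      using that fin[of k] by (subst card_Un_disjoint[symmetric]) (auto simp: Int_Un_distrib2)
    then show "eventually (\<lambda>k. \<mu> k (A \<union> B) = \<mu> k A + \<mu> k B) sequentially"
      by (simp add: \<mu>_def add_divide_distrib)
  qed (intro cont)+
  moreover have "\<nu> (g <# A) = \<nu> A" if g: "g \<in> carrier G" and A: "A \<subseteq> carrier G" for g A
  proof (rule limit[of "\<lambda>\<nu>. \<nu> (g <# A)" "\<lambda>\<nu>. \<nu> A"])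
    obtain j where j: "g \<in> H j" using g union by blast
    have "\<mu> k (g <# A) = \<mu> k A" if "k \<ge> j" for k
    proof -
      have gk: "g \<in> H k" using j that mono by (auto dest: incseqD)
      have "(g <# A) \<inter> H k = (\<lambda>a. g \<otimes> a) ` (A \<inter> H k)"
      proof (intro equalityI subsetI)
        fix y assume "y \<in> (g <# A) \<inter> H k"
        then obtain a where a: "a \<in> A" "y = g \<otimes> a" "g \<otimes> a \<in> H k" by (auto simp: l_coset_def)
        have "inv g \<otimes> (g \<otimes> a) \<in> H k"
          using a(3) gk sub by (meson subgroup.m_closed subgroup.m_inv_closed)
        moreover have "inv g \<otimes> (g \<otimes> a) = a"
          using a(1) A g by (metis inv_closed l_inv l_one m_assoc subsetD)
        ultimately show "y \<in> (\<lambda>a. g \<otimes> a) ` (A \<inter> H k)" using a by auto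
      qed (use gk sub in \<open>auto simp: l_coset_def intro: subgroup.m_closed\<close>)
      moreover have "inj_on (\<lambda>a. g \<otimes> a) (A \<inter> H k)"
        using g A by (intro inj_onI) (simp add: subset_iff)
      ultimately show ?thesis by (simp add: \<mu>_def card_image)
    qed
    then show "eventually (\<lambda>k. \<mu> k (g <# A) = \<mu> k A) sequentially"
      by (auto simp: eventually_sequentially)
  qed (intro cont)+
  ultimately show ?thesis
    unfolding amenable_def by (intro exI[of _ \<nu>]) blast
qed

section \<open>The finite subfields of the algebraic closure\<close>

text \<open>
  In characteristic two and inside an algebraically closed field, this is the field with
  \<open>2 ^ fact k\<close> elements. Factorials as exponents turn the divisibility order of the finite
  subfields into an increasing sequence.
\<close>

definition subfield_level :: "nat \<Rightarrow> 'k::field set" where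
  "subfield_level k = {x. x ^ (2 ^ fact k) = x}"

lemma frobenius_power_add:
  fixes x y :: "'k::field"
  assumes "CHAR('k) = 2"
  shows "(x + y) ^ (2 ^ n) = x ^ (2 ^ n) + y ^ (2 ^ n)"
  using freshmans_dream'[where 'a = 'k, of "2 ^ n" n x y] assms by simp

lemma frobenius_power_inj:
  fixes x y :: "'k::field"
  assumes "CHAR('k) = 2" and "x ^ (2 ^ n) = y ^ (2 ^ n)"
  shows "x = y"
proof -
  have "(x + y) ^ (2 ^ n) = 0"
    using assms double_eq_zero[OF assms(1)] by (simp add: frobenius_power_add)
  then have "x + y = y + y"
    using double_eq_zero[OF assms(1), of y] by simp
  then show ?thesis by simp
qed

lemma frobenius_fixed_dvd:
  fixes x :: "'k::field"
  assumes "x ^ (2 ^ m) = x" and "m dvd n"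
  shows "x ^ (2 ^ n) = x"
proof -
  obtain d where "n = m * d" using assms(2) by blast
  moreover have "x ^ (2 ^ (m * d)) = x"
    by (induction d) (simp_all add: power_add power_mult assms(1))
  ultimately show ?thesis by simp
qed

lemma finite_subfield_level: "finite (subfield_level k :: 'k::field set)"
proof -
  define p :: "'k poly" where "p = Polynomial.monom 1 (2 ^ fact k) - Polynomial.monom 1 1"
  have "(1::nat) < 2 ^ fact k" by (rule one_less_power) simp_all
  then have "poly.coeff p 1 \<noteq> 0" by (simp add: p_def)
  then have "p \<noteq> 0" by auto
  then have "finite {x. poly p x = 0}" by (rule poly_roots_finite)
  then show ?thesis by (simp add: p_def subfield_level_def poly_monom)
qed

lemma incseq_subfield_level: "incseq (subfield_level :: nat \<Rightarrow> 'k::field set)"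
  by (intro incseq_SucI subsetI) (auto simp: subfield_level_def intro: frobenius_fixed_dvd fact_dvd)

lemma subfield_level_closed:
  fixes x y :: "'k::field"
  assumes "CHAR('k) = 2" and "x \<in> subfield_level k" and "y \<in> subfield_level k"
  shows "x + y \<in> subfield_level k" "x * y \<in> subfield_level k" "- x \<in> subfield_level k"
proof -
  show "x + y \<in> subfield_level k" "x * y \<in> subfield_level k"
    using assms by (simp_all add: subfield_level_def frobenius_power_add power_mult_distrib)
  show "- x \<in> subfield_level k"
    using assms(2) by (simp only: uminus_CHAR_2[OF assms(1)])
qed

lemma CHAR_F2_alg: "CHAR(F2_alg) = 2"
proof -
  have "CHAR(bit) = 2"
  proof (rule CHAR_eqI)
    show "of_nat 2 = (0 :: bit)" by simp
    show "2 dvd n" if "of_nat n = (0 :: bit)" for n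
      using that by (induction n rule: nat_less_induct) (metis even_of_nat_iff even_zero)
  qed
  then show ?thesis by simp
qed

text \<open>
  Squaring permutes the finitely many roots of a polynomial with coefficients in the two-element
  field, so the iterated squares of an algebraic element repeat; injectivity of squaring makes the
  sequence purely periodic.
\<close>

lemma F2_alg_frobenius_periodic:
  fixes x :: F2_alg
  obtains m where "m > 0" "x ^ (2 ^ m) = x"
proof -
  obtain p :: "bit poly" where p: "p \<noteq> 0" "poly (map_poly to_ac p) x = 0"
    using alg_closure_algebraic .
  define q :: "F2_alg poly" where "q = map_poly to_ac p"
  have "poly.coeff q n = to_ac (poly.coeff p n)" for n by (simp add: q_def coeff_map_poly)
  then have coeff: "poly.coeff q n ^ 2 = poly.coeff q n" for n
    by (cases "poly.coeff p n") simp_all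
  have "q \<noteq> 0" using p(1) by (simp add: q_def map_poly_eq_0_iff)
  have square: "poly q (y ^ 2) = poly q y ^ 2" for y
  proof -
    have "poly q y ^ 2 = (\<Sum>n\<le>Polynomial.degree q. (poly.coeff q n * y ^ n) ^ 2)"
      unfolding poly_altdef by (rule freshmans_dream_sum) (simp_all only: CHAR_F2_alg two_is_prime_nat)
    also have "\<dots> = poly q (y ^ 2)"
      unfolding poly_altdef by (simp add: power_mult_distrib coeff flip: power_mult) (simp add: mult.commute)
    finally show ?thesis by simp
  qed
  have "poly q (x ^ (2 ^ n)) = 0" for n
  proof (induction n)
    case (Suc n)
    then show ?case using square[of "x ^ (2 ^ n)"] by (simp add: mult.commute flip: power_mult)
  qed (use p in \<open>simp add: q_def\<close>)
  then have "range (\<lambda>n. x ^ (2 ^ n)) \<subseteq> {y. poly q y = 0}" by auto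
  then have "finite (range (\<lambda>n. x ^ (2 ^ n)))"
    using poly_roots_finite[OF \<open>q \<noteq> 0\<close>] finite_subset by blast
  then have "\<not> inj (\<lambda>n::nat. x ^ (2 ^ n))"
    using finite_imageD infinite_UNIV_nat by blast
  then obtain k l :: nat where "k < l" "x ^ (2 ^ k) = x ^ (2 ^ l)"
    by (auto simp: inj_on_def) (metis linorder_neqE_nat)
  then have "(x ^ (2 ^ (l - k))) ^ (2 ^ k) = x ^ (2 ^ k)"
    by (simp flip: power_mult power_add)
  then have "x ^ (2 ^ (l - k)) = x" by (rule frobenius_power_inj[OF CHAR_F2_alg])
  with \<open>k < l\<close> that[of "l - k"] show thesis by simp
qed

lemma F2_alg_eq_Union_subfield_level: "(\<Union>k. subfield_level k) = (UNIV :: F2_alg set)"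
proof (intro equalityI subsetI)
  fix x :: F2_alg
  obtain m where "m > 0" "x ^ (2 ^ m) = x" by (rule F2_alg_frobenius_periodic)
  then have "x \<in> subfield_level m"
    by (auto simp: subfield_level_def intro!: frobenius_fixed_dvd[OF _ dvd_fact])
  then show "x \<in> (\<Union>k. subfield_level k)" by blast
qed simp

definition SL2_level :: "nat \<Rightarrow> ('k::field ^ 2 ^ 2) set" where
  "SL2_level k = {A \<in> carrier SL2. \<forall>i j. A $ i $ j \<in> subfield_level k}"

lemma finite_SL2_level: "finite (SL2_level k :: ('k::field ^ 2 ^ 2) set)"
proof -
  let ?F = "subfield_level k :: 'k set"
  let ?M = "\<lambda>(a, b, c, d). vector [vector [a, b], vector [c, d]] :: 'k ^ 2 ^ 2"
  have "SL2_level k \<subseteq> ?M ` (?F \<times> ?F \<times> ?F \<times> ?F)"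
  proof
    fix A :: "'k ^ 2 ^ 2" assume "A \<in> SL2_level k"
    then have "A = ?M (A$1$1, A$1$2, A$2$1, A$2$2)"
      "(A$1$1, A$1$2, A$2$1, A$2$2) \<in> ?F \<times> ?F \<times> ?F \<times> ?F"
      by (simp_all add: SL2_level_def vec_eq_iff forall_2)
    then show "A \<in> ?M ` (?F \<times> ?F \<times> ?F \<times> ?F)" by blast
  qed
  moreover have "finite (?M ` (?F \<times> ?F \<times> ?F \<times> ?F))"
    by (intro finite_imageI finite_cartesian_product finite_subfield_level)
  ultimately show ?thesis by (rule finite_subset)
qed

lemma subgroup_SL2_level:
  assumes char2: "CHAR('k::field) = 2"
  shows "subgroup (SL2_level k) (SL2 :: ('k ^ 2 ^ 2) monoid)"
proof -
  interpret SL2: group "SL2 :: ('k ^ 2 ^ 2) monoid" by (rule group_SL2)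
  note closed = subfield_level_closed[OF char2]
  show ?thesis
  proof (rule SL2.subgroupI)
    show "SL2_level k \<subseteq> carrier (SL2 :: ('k ^ 2 ^ 2) monoid)" by (auto simp: SL2_level_def)
    have "mat 1 \<in> (SL2_level k :: ('k ^ 2 ^ 2) set)"
      by (simp add: SL2_level_def SL2_def) (simp add: mat_def subfield_level_def)
    then show "(SL2_level k :: ('k ^ 2 ^ 2) set) \<noteq> {}" by blast
  next
    fix A :: "'k ^ 2 ^ 2" assume A: "A \<in> SL2_level k"
    define B :: "'k ^ 2 ^ 2" where
      "B = vector [vector [A$2$2, - A$1$2], vector [- A$2$1, A$1$1]]"
    have B: "B$1$1 = A$2$2" "B$1$2 = - A$1$2" "B$2$1 = - A$2$1" "B$2$2 = A$1$1"
      by (simp_all add: B_def)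
    have d: "A$1$1 * A$2$2 - A$1$2 * A$2$1 = 1"
      using A by (simp add: SL2_level_def SL2_def det_2)
    have "B \<in> SL2_level k"
      using A d closed(3) by (auto simp: SL2_level_def SL2_def det_2 B forall_2 algebra_simps)
    moreover have "B ** A = mat 1"
      using d by (simp add: vec_eq_iff forall_2 matrix_matrix_mult_def sum_2 B mat_def algebra_simps)
    ultimately have "inv\<^bsub>SL2\<^esub> A = B"
      using A by (intro SL2.inv_equality) (auto simp: SL2_level_def SL2_def)
    with \<open>B \<in> SL2_level k\<close> show "inv\<^bsub>SL2\<^esub> A \<in> SL2_level k" by simp
  next
    fix A B :: "'k ^ 2 ^ 2" assume AB: "A \<in> SL2_level k" "B \<in> SL2_level k"
    then have "(A ** B) $ i $ j \<in> subfield_level k" for i j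
      by (auto simp: SL2_level_def matrix_matrix_mult_def sum_2 intro!: closed(1,2))
    with AB show "A \<otimes>\<^bsub>SL2\<^esub> B \<in> SL2_level k"
      by (simp add: SL2_level_def SL2_def det_mul)
  qed
qed

lemma amenable_SL2_F2_alg: "amenable (SL2 :: (F2_alg ^ 2 ^ 2) monoid)"
proof -
  interpret SL2: group "SL2 :: (F2_alg ^ 2 ^ 2) monoid" by (rule group_SL2)
  show ?thesis
  proof (rule SL2.amenable_if_increasing_union_of_finite_subgroups)
    show "subgroup (SL2_level k) (SL2 :: (F2_alg ^ 2 ^ 2) monoid)" for k
      by (rule subgroup_SL2_level[OF CHAR_F2_alg])
    show "finite (SL2_level k :: (F2_alg ^ 2 ^ 2) set)" for k by (rule finite_SL2_level)
    show "incseq (SL2_level :: nat \<Rightarrow> (F2_alg ^ 2 ^ 2) set)"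
      using incseq_subfield_level by (fastforce simp: incseq_def SL2_level_def)
    show "(\<Union>k. SL2_level k) = carrier (SL2 :: (F2_alg ^ 2 ^ 2) monoid)"
    proof (intro equalityI subsetI)
      fix A :: "F2_alg ^ 2 ^ 2" assume A: "A \<in> carrier SL2"
      have "\<forall>x::F2_alg. \<exists>k. x \<in> subfield_level k"
        using F2_alg_eq_Union_subfield_level by blast
      then obtain l where l: "\<And>x::F2_alg. x \<in> subfield_level (l x)" by metis
      define k where "k = Max (range (\<lambda>(i, j). l (A $ i $ j)))"
      have "l (A $ i $ j) \<le> k" for i j
        unfolding k_def by (rule Max_ge) (auto intro: range_eqI[of _ _ "(i, j)"])
      then have "A $ i $ j \<in> subfield_level k" for i j
        using l incseq_subfield_level by (metis incseqD subsetD)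
      with A show "A \<in> (\<Union>k. SL2_level k)" by (auto simp: SL2_level_def)
    qed (auto simp: SL2_level_def)
  qed
qed

theorem corollary4p5:
  shows "amenable (SL2 :: (F2_alg ^ 2 ^ 2) monoid) \<and>
    \<not> uniformly_inner_amenable (SL2 :: (F2_alg ^ 2 ^ 2) monoid)"
  using amenable_SL2_F2_alg not_uniformly_inner_amenable_SL2[OF CHAR_F2_alg infinite_alg_closed]
  by blast

end
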